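(* Let $n$ be a positive integer and let $A_k(x)=\sum_{j=0}^{k}\binom{k}{j}^2\binom{k+j}{j}^2x^j$ for $k\ge 0$. Then, as polynomials in $x$, $$\frac{1}{n}\sum_{k=0}^{n-1}(-1)^k(2k+1)A_k(x)=(-1)^{n-1}\sum_{m=0}^{n-1}\binom{2m}{m}x^m\sum_{k=0}^{m}\binom{m}{k}\binom{m+k}{k}\binom{n-1}{m+k}\binom{n+m+k}{m+k}.$$ *)

theory Defs
  imports "HOL-Computational_Algebra.Polynomial"
begin

(* The coefficients are integers; rationals are used since identities for A divide by n. *)
definition A :: "nat \<Rightarrow> rat poly" where
  "A k = (\<Sum>j=0..k. monom (of_nat ((k choose j)^2 * ((k + j) choose j)^2)) j)"

end

theory Submission
  imports Defs
begin

text \<open>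
  Put \<open>b\<^sub>i(k) = (k choose i) (k+i choose i)\<close>, so that the coefficient of \<open>x\<^sup>m\<close> in \<open>A\<^sub>k\<close> is
  \<open>b\<^sub>m(k)\<^sup>2\<close>. Since \<open>b\<^sub>i(k)\<close> is, up to the factor \<open>i!\<^sup>2\<close>, the product of the
  \<open>k(k+1) - l(l+1)\<close> over \<open>l < i\<close>, a product of two such functions is a combination of functions of
  the same kind:
  \<open>b\<^sub>r b\<^sub>m = \<Sum>\<^sub>j (m+r choose r) (r choose j) (m+j choose r) b\<^sub>m\<^sub>+\<^sub>j\<close>,
  by induction on \<open>r\<close>. For \<open>r = m\<close> this expands \<open>b\<^sub>m\<^sup>2\<close>, and the sums
  \<open>\<Sum>\<^sub>k\<^sub><\<^sub>n (-1)\<^sup>k (2k+1) b\<^sub>i(k)\<close> telescope.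
\<close>

definition b :: "nat \<Rightarrow> nat \<Rightarrow> rat" where
  "b i k = of_nat ((k choose i) * ((k + i) choose i))"

definition c :: "nat \<Rightarrow> nat \<Rightarrow> nat \<Rightarrow> rat" where
  "c r m j = of_nat (((m + r) choose r) * (r choose j) * ((m + j) choose r))"

text \<open>The difference is taken in the field, so nothing is truncated: for \<open>k < i\<close>
  both binomials vanish, for \<open>k = i\<close> the factor does.\<close>

lemma of_nat_Suc_times_binomial_Suc:
  "(of_nat i + 1) * of_nat (k choose Suc i) =
    (of_nat k - of_nat i :: 'a::field_char_0) * of_nat (k choose i)"
  by (simp add: binomial_gbinomial gbinomial_absorption' gbinomial_mult_1 algebra_simps)

lemma of_nat_Suc_times_binomial_Suc_Suc:
  "(of_nat i + 1) * of_nat (Suc k choose Suc i) =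
    (of_nat k + 1 :: 'a::comm_semiring_1) * of_nat (k choose i)"
proof -
  have "of_nat (Suc i * (Suc k choose Suc i)) = (of_nat (Suc k * (k choose i)) :: 'a)"
    by (simp only: Suc_times_binomial_eq mult.commute)
  then show ?thesis by (simp only: of_nat_mult of_nat_Suc add.commute)
qed

lemma of_nat_Suc_times_binomial:
  "(of_nat k + 1) * of_nat (k choose i) =
    (of_nat k + 1 - of_nat i :: 'a::field_char_0) * of_nat (Suc k choose i)"
  using of_nat_Suc_times_binomial_Suc[of i "Suc k", where 'a='a]
    of_nat_Suc_times_binomial_Suc_Suc[of i k, where 'a='a]
  by (metis of_nat_Suc add.commute)

text \<open>The factor is k(k+1) - i(i+1). Read from right to left, this trades multiplication by it
  for a shift of the index.\<close>

lemma b_Suc: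
  "(of_nat i + 1)^2 * b (Suc i) k = (of_nat k - of_nat i) * (of_nat k + of_nat i + 1) * b i k"
proof -
  have "(of_nat i + 1)^2 * b (Suc i) k =
     ((of_nat i + 1) * of_nat (k choose Suc i)) *
     ((of_nat i + 1) * of_nat (Suc (k + i) choose Suc i))"
    by (simp add: b_def power2_eq_square del: binomial_Suc_Suc)
  then show ?thesis
    unfolding of_nat_Suc_times_binomial_Suc[of i k]
      of_nat_Suc_times_binomial_Suc_Suc[of i "k + i"]
    by (simp add: b_def)
qed

text \<open>Since \<open>c r m 0\<close> is \<open>b r m\<close>, this is the recurrence
  \<open>b_Suc\<close> at \<open>k = m\<close>.\<close>

lemma c_Suc_0:
  "(of_nat r + 1)^2 * c (Suc r) m 0 = (of_nat m - of_nat r) * (of_nat m + of_nat r + 1) * c r m 0"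
proof -
  have "(of_nat r + 1)^2 * c (Suc r) m 0 =
     ((of_nat r + 1) * of_nat (Suc (m + r) choose Suc r)) *
     ((of_nat r + 1) * of_nat (m choose Suc r))"
    by (simp add: c_def power2_eq_square del: binomial_Suc_Suc)
  then show ?thesis
    unfolding of_nat_Suc_times_binomial_Suc[of r m]
      of_nat_Suc_times_binomial_Suc_Suc[of r "m + r"]
    by (simp add: c_def)
qed

text \<open>What comparing coefficients of \<open>b (m + Suc j)\<close> demands in the induction for
  \<open>b_times_b\<close>: one contribution is raised from index \<open>j\<close>, the other stays
  at \<open>Suc j\<close>.\<close>

lemma c_Suc_Suc:
  "(of_nat r + 1)^2 * c (Suc r) m (Suc j) = (of_nat (m + Suc j))^2 * c r m j +
     (of_nat (m + Suc j) - of_nat r) * (of_nat (m + Suc j) + of_nat r + 1) * c r m (Suc j)"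
proof -
  define P Q R S :: rat where "P = of_nat ((m + r) choose r)"
    and "Q = of_nat (Suc (m + j) choose r)"
    and "R = of_nat (r choose j)" and "S = of_nat (r choose Suc j)"
  define x y z :: rat where "x = of_nat m" and "y = of_nat r" and "z = of_nat j"
  have S: "(z + 1) * S = (y - z) * R"
    unfolding S_def R_def y_def z_def by (rule of_nat_Suc_times_binomial_Suc)
  have "(of_nat r + 1)^2 * c (Suc r) m (Suc j) =
     ((of_nat r + 1) * of_nat (Suc (m + r) choose Suc r)) *
     ((of_nat r + 1) * of_nat (Suc (m + j) choose Suc r)) * of_nat (Suc r choose Suc j)"
    by (simp add: c_def power2_eq_square del: binomial_Suc_Suc)
  also have "\<dots> = (x + y + 1) * P * ((x + z + 1 - y) * Q) * (R + S)"
    unfolding of_nat_Suc_times_binomial_Suc_Suc[of r "m + r"]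
      of_nat_Suc_times_binomial_Suc[of r "Suc (m + j)"]
    by (simp add: P_def Q_def R_def S_def x_def y_def z_def algebra_simps)
  also have "\<dots> = P * ((x + z + 1 - y) * Q) * ((x + z + 1) * R + (x + z + 1 + y + 1) * S)"
    using S by algebra
  also have "\<dots> = (x + z + 1) * P * R * ((x + z + 1 - y) * Q) +
      (x + z + 1 - y) * (x + z + 1 + y + 1) * (P * S * Q)"
    by algebra
  \<comment> \<open>Only the summand with \<open>R\<close> has this product as a subterm; the
    rewriting turns it into \<open>c r m j\<close>, while the summand with \<open>S\<close> keeps
    \<open>Q\<close>, as in \<open>c r m (Suc j)\<close>.\<close>
  also have "(x + z + 1 - y) * Q = (x + z + 1) * of_nat ((m + j) choose r)"
    using of_nat_Suc_times_binomial[of "m + j" r, where 'a=rat]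
    by (simp add: Q_def x_def y_def z_def)
  finally show ?thesis
    by (simp add: c_def P_def Q_def R_def S_def x_def y_def z_def algebra_simps power2_eq_square
        del: binomial_Suc_Suc)
qed

lemma b_times_b: "b r k * b m k = (\<Sum>j\<le>r. c r m j * b (m + j) k)"
proof (induction r)
  case 0
  then show ?case by (simp add: b_def c_def)
next
  case (Suc r)
  \<comment> \<open>With s = m+j, split k(k+1) - r(r+1) as [k(k+1) - s(s+1)] + [s(s+1) - r(r+1)]:
    the first bracket raises \<open>b s\<close> by \<open>b_Suc\<close>, the second is the scalar
    \<open>d j\<close>.\<close>
  define d where "d j = (of_nat (m + j) - of_nat r) * (of_nat (m + j) + of_nat r + 1 :: rat)" for j
  have step: "(of_nat k - of_nat r) * (of_nat k + of_nat r + 1) * b (m + j) k =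
      (of_nat (m + Suc j))^2 * b (m + Suc j) k + d j * b (m + j) k" for j
    using b_Suc[of "m + j" k] unfolding d_def by (simp add: algebra_simps)
  \<comment> \<open>This zero term extends the second sum to \<open>Suc r\<close>; splitting off j =
    0 then aligns it with the raised sum.\<close>
  have last: "c r m (Suc r) = 0" by (simp add: c_def)
  have "(of_nat r + 1)^2 * (b (Suc r) k * b m k) =
      (of_nat k - of_nat r) * (of_nat k + of_nat r + 1) * (b r k * b m k)"
    using b_Suc[of r k] by algebra
  also have "\<dots> = (\<Sum>j\<le>r. c r m j * ((of_nat k - of_nat r) * (of_nat k + of_nat r + 1) * b (m + j) k))"
    unfolding Suc sum_distrib_left by (simp add: mult_ac)
  also have "\<dots> = (\<Sum>j\<le>r. (of_nat (m + Suc j))^2 * c r m j * b (m + Suc j) k) +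
      (\<Sum>j\<le>r. d j * c r m j * b (m + j) k)"
    unfolding step by (simp add: distrib_left sum.distrib mult_ac)
  also have "(\<Sum>j\<le>r. d j * c r m j * b (m + j) k) = (\<Sum>j\<le>Suc r. d j * c r m j * b (m + j) k)"
    using last by simp
  also have "\<dots> = d 0 * c r m 0 * b m k + (\<Sum>j\<le>r. d (Suc j) * c r m (Suc j) * b (m + Suc j) k)"
    by (simp only: sum.atMost_Suc_shift add_0_right)
  also have "d 0 * c r m 0 = (of_nat r + 1)^2 * c (Suc r) m 0"
    unfolding d_def c_Suc_0 by simp
  also have "(\<Sum>j\<le>r. (of_nat (m + Suc j))^2 * c r m j * b (m + Suc j) k) +
      ((of_nat r + 1)^2 * c (Suc r) m 0 * b m k +
       (\<Sum>j\<le>r. d (Suc j) * c r m (Suc j) * b (m + Suc j) k)) =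
      (of_nat r + 1)^2 * c (Suc r) m 0 * b m k +
      (\<Sum>j\<le>r. (of_nat r + 1)^2 * c (Suc r) m (Suc j) * b (m + Suc j) k)"
    unfolding c_Suc_Suc d_def by (simp add: distrib_right sum.distrib)
  also have "\<dots> = (of_nat r + 1)^2 * (\<Sum>j\<le>Suc r. c (Suc r) m j * b (m + j) k)"
    by (simp only: sum.atMost_Suc_shift add_0_right sum_distrib_left distrib_left mult.assoc)
  finally show ?case
    by (simp add: add_eq_0_iff_both_eq_0 flip: of_nat_Suc del: of_nat_Suc)
qed

text \<open>The factor \<open>Suc n\<close> in the closed form is what cancels the 1/n of the
  theorem.\<close>

lemma alternating_sum_b:
  "(\<Sum>k\<le>n. (-1)^k * of_nat (2 * k + 1) * b i k) =
    (-1)^n * of_nat (Suc n) * of_nat ((n choose i) * ((Suc n + i) choose i))"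
proof (induction n)
  case 0
  then show ?case by (cases i) (auto simp: b_def)
next
  case (Suc n)
  define x y :: rat where "x = of_nat n" and "y = of_nat i"
  define P Q :: rat where "P = of_nat (Suc n choose i)" and "Q = of_nat ((Suc n + i) choose i)"
  have 1: "(x + 1) * of_nat (n choose i) = (x + 1 - y) * P"
    unfolding x_def y_def P_def by (rule of_nat_Suc_times_binomial)
  have 2: "(x + 2) * of_nat ((Suc (Suc n) + i) choose i) = (x + 2 + y) * Q"
    using of_nat_Suc_times_binomial[of "Suc n + i" i, where 'a=rat]
    by (simp add: x_def y_def Q_def algebra_simps)
  have "(\<Sum>k\<le>Suc n. (-1)^k * of_nat (2 * k + 1) * b i k) =
      (-1)^n * ((x + 1) * of_nat (n choose i) * Q - (2 * x + 3) * (P * Q))"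
    unfolding sum.atMost_Suc Suc
    by (simp add: x_def P_def Q_def b_def algebra_simps del: binomial_Suc_Suc)
  \<comment> \<open>After factoring out P Q, the bracket is (x+1-y) - (2x+3) = -(x+2+y).\<close>
  also have "\<dots> = (-1)^Suc n * (P * ((x + 2 + y) * Q))"
    unfolding 1 by (simp add: algebra_simps)
  also have "\<dots> = (-1)^Suc n * (P * ((x + 2) * of_nat ((Suc (Suc n) + i) choose i)))"
    unfolding 2 ..
  finally show ?case
    by (simp add: x_def P_def algebra_simps del: binomial_Suc_Suc)
qed

lemma coeff_A: "coeff (A k) m = b m k * b m k"
  by (simp add: A_def coeff_sum b_def binomial_eq_0 power2_eq_square)

theorem theorem2p1:
  fixes n :: nat
  assumes "n > 0"
  shows "smult (1 / of_nat n) (\<Sum>k=0..n-1. smult ((-1)^k * of_nat (2*k + 1)) (A k)) =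
    smult ((-1)^(n-1))
      (\<Sum>m=0..n-1. monom (of_nat (((2*m) choose m) *
        (\<Sum>k=0..m. (m choose k) * ((m + k) choose k) *
           ((n - 1) choose (m + k)) * ((n + m + k) choose (m + k))))) m)"
    (is "?L = smult _ (\<Sum>m=0..n-1. monom (of_nat (?g m)) m)")
proof (rule poly_eqI)
  fix m
  have c: "c m m j = of_nat ((2 * m choose m) * (m choose j) * ((m + j) choose j))" for j
    using binomial_symmetric[of j "m + j"] by (simp add: c_def mult_2)
  have "coeff ?L m = 1 / of_nat n *
      (\<Sum>k\<le>n-1. \<Sum>j\<le>m. (-1)^k * of_nat (2*k + 1) * (c m m j * b (m + j) k))"
    by (simp only: coeff_smult coeff_sum coeff_A b_times_b sum_distrib_left atLeast0AtMost)
  also have "\<dots> = 1 / of_nat n *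
      (\<Sum>j\<le>m. c m m j * (\<Sum>k\<le>n-1. (-1)^k * of_nat (2*k + 1) * b (m + j) k))"
    by (subst sum.swap) (simp only: sum_distrib_left mult_ac)
  \<comment> \<open>Positivity of \<open>n\<close> gives \<open>Suc (n - 1) = n\<close>, both for
    the cancellation and inside the binomial.\<close>
  also have "\<dots> = (-1)^(n-1) * of_nat (?g m)"
    unfolding alternating_sum_b c using assms
    by (simp add: sum_distrib_left atLeast0AtMost mult_ac add.assoc)
  \<comment> \<open>For \<open>m \<ge> n\<close> the factors \<open>(n - 1) choose (m + k)\<close>
    all vanish, in agreement with the truncated sum.\<close>
  also have "of_nat (?g m) = coeff (\<Sum>m=0..n-1. monom (of_nat (?g m)) m :: rat poly) m"
    using assms by (auto simp: coeff_sum binomial_eq_0)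
  finally show "coeff ?L m = coeff (smult ((-1)^(n-1))
      (\<Sum>m=0..n-1. monom (of_nat (?g m)) m)) m"
    by simp
qed

end
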